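(* Let $D$ be a domain in $\mathbb{C}$. Then $h(D)\le b(D)$. Moreover, if $D$ is bounded, then $h(D)=b(D)=+\infty$, and if $\mathbb{C}\setminus D$ is bounded, then $h(D)=b(D)=0$.
   Context: $\mathbb{D}$ is the unit disk in $\mathbb{C}$; a domain is a nonempty connected open set; $H(\mathbb{D},D)$ is the set of holomorphic functions on $\mathbb{D}$ with values in $D$. For $p>0$, $H^p(\mathbb{D})$ is the set of holomorphic $f$ on $\mathbb{D}$ with $\sup_{0<r<1}\int_0^{2\pi}|f(re^{i\theta})|^p\,d\theta<+\infty$. For $p>0$, $\alpha>-1$, $A^p_\alpha(\mathbb{D})$ is the set of holomorphic $f$ on $\mathbb{D}$ with $\int_{\mathbb{D}}|f(z)|^p(1-|z|^2)^\alpha\,dA(z)<+\infty$, where $dA$ is Lebesgue area measure. For $f$ holomorphic on $\mathbb{D}$, $h(f)=\sup\{p>0: f\in H^p(\mathbb{D})\}\in[0,+\infty]$ and $b(f)=\sup\{\frac{p}{\alpha+2}: p>0,\ \alpha>-1,\ f\in A^p_\alpha(\mathbb{D})\}\in[0,+\infty]$ (with $\sup\emptyset=0$). For a domain $D\subset\mathbb{C}$, the Hardy number is $h(D)=\sup\{p>0: |z|^p \text{ has a harmonic majorant on } D\}$; equivalently (known, Kim–Sugawa) $h(D)=\inf\{h(f): f\in H(\mathbb{D},D)\}=\sup\{p>0: H(\mathbb{D},D)\subset H^p(\mathbb{D})\}$. The Bergman number is $b(D)=\inf\{b(f): f\in H(\mathbb{D},D)\}\in[0,+\infty]$. *)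

theory Defs
  imports "HOL-Complex_Analysis.Complex_Analysis"
begin

text \<open>
  A real function on an open set is harmonic if it is twice continuously differentiable and its
  Laplacian vanishes. Here \<open>ux\<close>, \<open>uy\<close> are the first and \<open>uxx\<close>, \<open>uxy\<close>, \<open>uyx\<close>, \<open>uyy\<close> the second
  partial derivatives of \<open>u\<close> with respect to \<open>x = Re z\<close> and \<open>y = Im z\<close>. Continuity of \<open>u\<close>, \<open>ux\<close>
  and \<open>uy\<close> is implied by differentiability.
\<close>

definition harmonic_on :: "(complex \<Rightarrow> real) \<Rightarrow> complex set \<Rightarrow> bool"
    (infixl "harmonic'_on" 50) where
  "u harmonic_on S \<longleftrightarrow>
    (\<exists>ux uy uxx uxy uyx uyy.
      (\<forall>z\<in>S.
        (u has_derivative (\<lambda>h. ux z * Re h + uy z * Im h)) (at z) \<and>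
        (ux has_derivative (\<lambda>h. uxx z * Re h + uxy z * Im h)) (at z) \<and>
        (uy has_derivative (\<lambda>h. uyx z * Re h + uyy z * Im h)) (at z) \<and>
        uxx z + uyy z = 0) \<and>
      continuous_on S uxx \<and> continuous_on S uxy \<and>
      continuous_on S uyx \<and> continuous_on S uyy)"

definition has_harmonic_majorant_on :: "(complex \<Rightarrow> real) \<Rightarrow> complex set \<Rightarrow> bool" where
  "has_harmonic_majorant_on v D \<longleftrightarrow> (\<exists>u. u harmonic_on D \<and> (\<forall>z\<in>D. v z \<le> u z))"

text \<open>
  Exponents are taken in \<^typ>\<open>ennreal\<close>, that is in \<open>[0, \<infinity>]\<close>, where the supremum of the empty set
  is \<open>0\<close>.
\<close>

definition hardy_number :: "complex set \<Rightarrow> ennreal" where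
  "hardy_number D = Sup {ennreal p | p. p > 0 \<and> has_harmonic_majorant_on (\<lambda>z. cmod z powr p) D}"

definition bergman_space :: "real \<Rightarrow> real \<Rightarrow> (complex \<Rightarrow> complex) set" where
  "bergman_space p \<alpha> = {f. f holomorphic_on ball 0 1 \<and>
    (\<integral>\<^sup>+z\<in>ball 0 1. ennreal (cmod (f z) powr p * (1 - (cmod z)\<^sup>2) powr \<alpha>) \<partial>lborel) < \<infinity>}"

definition bergman_number_fun :: "(complex \<Rightarrow> complex) \<Rightarrow> ennreal" where
  "bergman_number_fun f =
    Sup {ennreal (p / (\<alpha> + 2)) | p \<alpha>. p > 0 \<and> \<alpha> > -1 \<and> f \<in> bergman_space p \<alpha>}"

definition bergman_number :: "complex set \<Rightarrow> ennreal" where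
  "bergman_number D =
    Inf {bergman_number_fun f | f. f holomorphic_on ball 0 1 \<and> f ` ball 0 1 \<subseteq> D}"

end

theory Submission
  imports Defs "HOL-Real_Asymp.Real_Asymp"
begin

text \<open>
  Let \<open>u\<close> be a harmonic majorant of \<open>|w|\<^sup>p\<close> on \<open>D\<close> and let \<open>f\<close> map the disc into \<open>D\<close>. The mean value
  property of \<open>u \<circ> f\<close> bounds the means of \<open>|f|\<^sup>p\<close> over all circles centred at \<open>0\<close> by \<open>u (f 0)\<close>. The
  area integral of \<open>|f|\<^sup>p\<close> against a radial weight does not change when \<open>f\<close> is rotated, so averaging
  over the rotations (instead of using polar coordinates) shows that \<open>f\<close> lies in every weighted
  Bergman space with \<open>-1 < \<alpha> < 0\<close>; now let \<open>\<alpha> \<rightarrow> -1\<close>. If \<open>D\<close> contains all \<open>w\<close> with \<open>|w| > R\<close>, then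
  \<open>R exp ((1 + z) / (1 - z))\<close> maps the disc into \<open>D\<close> and lies in no weighted Bergman space.
\<close>

section \<open>Translations, rotations and Lebesgue measure\<close>

lemma nn_integral_lborel_translation:
  fixes g :: "'a::euclidean_space \<Rightarrow> ennreal"
  assumes [measurable]: "g \<in> borel_measurable borel"
  shows "(\<integral>\<^sup>+x. g (x + a) \<partial>lborel) = (\<integral>\<^sup>+x. g x \<partial>lborel)"
proof -
  have "(\<integral>\<^sup>+x. g x \<partial>lborel) = (\<integral>\<^sup>+x. g x \<partial>distr lborel borel ((+) a))"
    by (simp add: lborel_distr_plus)
  also have "\<dots> = (\<integral>\<^sup>+x. g (x + a) \<partial>lborel)"
    by (subst nn_integral_distr) (simp_all add: add.commute)
  finally show ?thesis ..
qed

text \<open>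
  As in the uniqueness proof for Haar measure, the integral of \<open>indicator A (T x) * indicator B (y - T x)\<close>
  over \<open>x\<close> and \<open>y\<close> is evaluated in both orders, where \<open>B\<close> is the unit ball.
\<close>

lemma lborel_distr_orthogonal:
  fixes T :: "'a::euclidean_space \<Rightarrow> 'a"
  assumes T: "orthogonal_transformation T"
  shows "distr lborel borel T = lborel"
proof (rule measure_eqI)
  show "sets (distr lborel borel T) = sets (lborel :: 'a measure)"
    by simp
next
  fix A :: "'a set"
  assume "A \<in> sets (distr lborel borel T)"
  then have A [measurable]: "A \<in> sets borel"
    by simp
  have "linear T"
    using T by (rule orthogonal_transformation_linear)
  then have [measurable]: "T \<in> borel_measurable borel"
    by (intro borel_measurable_continuous_onI linear_continuous_on linear_conv_bounded_linear[THEN iffD1])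
  \<comment> \<open>The ball is invariant under \<open>T\<close> and under negation, so
    \<open>T\<close> drops out of its indicator; its measure is positive and finite, so it can be
    cancelled at the end.\<close>
  define B where "B = ball (0::'a) 1"
  have [measurable]: "B \<in> sets borel"
    by (simp add: B_def)
  have B_T: "indicator B (- T x) = (indicator B x :: ennreal)" for x
    using T by (simp add: B_def orthogonal_transformation_norm indicator_def)
  have B_finite: "emeasure lborel B \<noteq> top" "emeasure lborel B \<noteq> 0"
    by (simp_all add: B_def emeasure_ball ennreal_eq_0_iff not_le)
  have shift: "(\<integral>\<^sup>+y. indicator E (y + a) \<partial>lborel) = emeasure lborel E"
    if "E \<in> sets borel" for E :: "'a set" and a
    using that by (subst nn_integral_lborel_translation) simp_all
  have "emeasure (distr lborel borel T) A * emeasure lborel B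
      = (\<integral>\<^sup>+x. indicator A (T x) * emeasure lborel B \<partial>lborel)"
    by (simp add: nn_integral_multc emeasure_distr flip: nn_integral_indicator indicator_vimage[symmetric])
       (simp add: nn_integral_distr flip: nn_integral_indicator)
  also have "\<dots> = (\<integral>\<^sup>+x. \<integral>\<^sup>+y. indicator A (T x) * indicator B (y + - T x) \<partial>lborel \<partial>lborel)"
    by (subst nn_integral_cmult) (measurable, simp only: shift[OF \<open>B \<in> sets borel\<close>])
  also have "\<dots> = (\<integral>\<^sup>+y. \<integral>\<^sup>+x. indicator A (T x) * indicator B (y + - T x) \<partial>lborel \<partial>lborel)"
    by (rule lborel_pair.Fubini') measurable
  also have "\<dots> = (\<integral>\<^sup>+y. \<integral>\<^sup>+x. indicator A (y + T x) * indicator B (- T x) \<partial>lborel \<partial>lborel)"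
  proof (rule nn_integral_cong)
    fix y :: 'a
    \<comment> \<open>Translating \<open>x\<close> by a preimage \<open>s\<close> of
      \<open>y\<close> turns \<open>T x\<close> into \<open>y + T x\<close>, which moves
      \<open>y\<close> from the argument of \<open>B\<close> to that of \<open>A\<close>.\<close>
    obtain s where s: "y = T s"
      using orthogonal_transformation_surj[OF T] by (metis surjD)
    have "(\<integral>\<^sup>+x. indicator A (T x) * indicator B (y + - T x) \<partial>lborel)
        = (\<integral>\<^sup>+x. indicator A (T (x + s)) * indicator B (y + - T (x + s)) \<partial>lborel)"
      by (rule nn_integral_lborel_translation[symmetric]) measurable
    also have "\<dots> = (\<integral>\<^sup>+x. indicator A (y + T x) * indicator B (- T x) \<partial>lborel)"
      by (simp add: linear_add[OF \<open>linear T\<close>] s add.commute)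
    finally show "(\<integral>\<^sup>+x. indicator A (T x) * indicator B (y + - T x) \<partial>lborel) = \<dots>" .
  qed
  also have "\<dots> = (\<integral>\<^sup>+x. \<integral>\<^sup>+y. indicator A (y + T x) * indicator B (- T x) \<partial>lborel \<partial>lborel)"
    by (rule lborel_pair.Fubini') measurable
  also have "\<dots> = (\<integral>\<^sup>+x. emeasure lborel A * indicator B x \<partial>lborel)"
    by (subst nn_integral_multc) (measurable, simp only: shift[OF A] B_T)
  also have "\<dots> = emeasure lborel A * emeasure lborel B"
    by (simp add: nn_integral_cmult)
  finally show "emeasure (distr lborel borel T) A = emeasure lborel A"
    using B_finite by (metis ennreal_mult_divide_eq)
qed

text \<open>Multiplication by a unimodular constant is an orthogonal map of the plane.\<close>

lemma nn_integral_lborel_rotate: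
  fixes g :: "complex \<Rightarrow> ennreal"
  assumes [measurable]: "g \<in> borel_measurable borel" and c: "cmod c = 1"
  shows "(\<integral>\<^sup>+z. g (c * z) \<partial>lborel) = (\<integral>\<^sup>+z. g z \<partial>lborel)"
proof -
  have "orthogonal_transformation ((*) c)"
    using c by (simp add: orthogonal_transformation norm_mult bounded_linear.linear bounded_linear_mult_right)
  then have "(\<integral>\<^sup>+z. g z \<partial>lborel) = (\<integral>\<^sup>+z. g z \<partial>distr lborel borel ((*) c))"
    by (simp add: lborel_distr_orthogonal)
  also have "\<dots> = (\<integral>\<^sup>+z. g (c * z) \<partial>lborel)"
    by (subst nn_integral_distr) simp_all
  finally show ?thesis ..
qed

section \<open>Harmonic functions composed with holomorphic maps and their circle means\<close>

lemma harmonic_on_imp_continuous_on: "u harmonic_on D \<Longrightarrow> continuous_on D u"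
  unfolding harmonic_on_def by (meson continuous_at_imp_continuous_on has_derivative_continuous)

text \<open>The direction \<open>d\<close> will be \<open>1\<close> or the imaginary unit, for
  horizontal and vertical lines. Besides \<open>u\<close> and its partial derivatives,
  \<open>g\<close> will be \<open>Re\<close> or \<open>Im\<close>, which differentiates the
  components of a holomorphic function.\<close>

lemma gradient_chain_rule:
  fixes g :: "complex \<Rightarrow> real" and F :: "complex \<Rightarrow> complex"
  assumes g: "(g has_derivative (\<lambda>h. gx * Re h + gy * Im h)) (at (F (\<gamma> x)))"
    and F: "(F has_field_derivative F') (at (\<gamma> x))"
    and \<gamma>: "(\<gamma> has_vector_derivative d) (at x within S)"
  shows "((\<lambda>x. g (F (\<gamma> x))) has_field_derivative (gx * Re (F' * d) + gy * Im (F' * d))) (at x within S)"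
proof -
  have "((\<lambda>x. F (\<gamma> x)) has_derivative (\<lambda>h. F' * (h *\<^sub>R d))) (at x within S)"
    using has_derivative_compose[OF \<gamma>[unfolded has_vector_derivative_def] F[unfolded has_field_derivative_def]]
    by simp
  from has_derivative_compose[OF this g] show ?thesis
    by (auto simp: has_field_derivative_def algebra_simps elim!: has_derivative_eq_rhs)
qed

text \<open>
  In the coordinates \<open>t + \<i> \<theta>\<close>, where the circles are the vertical segments, the integral of a
  harmonic function over a segment is affine in \<open>t\<close>; it converges as \<open>t \<rightarrow> -\<infinity>\<close>, so it is constant.
\<close>

theorem harmonic_comp_mean_value:
  fixes f :: "complex \<Rightarrow> complex"
  assumes u: "u harmonic_on D" and f: "f holomorphic_on ball 0 1" and fD: "f ` ball 0 1 \<subseteq> D"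
    and z: "cmod z < 1"
  shows "((\<lambda>\<theta>. u (f (cis \<theta> * z))) has_integral 2 * pi * u (f 0)) {0..2 * pi}"
proof -
  obtain ux uy uxx uxy uyx uyy where
    du: "\<And>w. w \<in> D \<Longrightarrow> (u has_derivative (\<lambda>h. ux w * Re h + uy w * Im h)) (at w)"
    and dux: "\<And>w. w \<in> D \<Longrightarrow> (ux has_derivative (\<lambda>h. uxx w * Re h + uxy w * Im h)) (at w)"
    and duy: "\<And>w. w \<in> D \<Longrightarrow> (uy has_derivative (\<lambda>h. uyx w * Re h + uyy w * Im h)) (at w)"
    and lap: "\<And>w. w \<in> D \<Longrightarrow> uxx w + uyy w = 0"
    and c2: "continuous_on D uxx" "continuous_on D uxy" "continuous_on D uyx" "continuous_on D uyy"
    using u unfolding harmonic_on_def by blast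
  have c1: "continuous_on D u" "continuous_on D ux" "continuous_on D uy"
    using harmonic_on_imp_continuous_on[OF u]
    by (auto intro!: continuous_at_imp_continuous_on has_derivative_continuous dux duy)
  define f1 where "f1 = deriv f"
  define f2 where "f2 = deriv f1"
  have f1: "f1 holomorphic_on ball 0 1" and f2: "f2 holomorphic_on ball 0 1"
    unfolding f1_def f2_def by (intro holomorphic_deriv f open_ball)+
  have df: "(f has_field_derivative f1 w) (at w)" if "w \<in> ball 0 1" for w
    using holomorphic_derivI[OF f open_ball that] by (simp add: f1_def)
  have df1: "(f1 has_field_derivative f2 w) (at w)" if "w \<in> ball 0 1" for w
    using holomorphic_derivI[OF f1 open_ball that] by (simp add: f2_def)

  \<comment> \<open>For \<open>s = t + i \<theta>\<close> in \<open>H\<close>, the point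
    \<open>z * exp s\<close> has modulus \<open>|z| exp t\<close>; \<open>F\<close> is
    \<open>f\<close> in these coordinates, and \<open>F1\<close>, \<open>F2\<close> are its first
    two derivatives in \<open>s\<close>.\<close>
  define H where "H = {s. Re s \<le> 0}"
  define F where "F = (\<lambda>s. f (z * exp s))"
  define F1 where "F1 = (\<lambda>s. f1 (z * exp s) * (z * exp s))"
  define F2 where "F2 = (\<lambda>s. f2 (z * exp s) * (z * exp s)\<^sup>2 + f1 (z * exp s) * (z * exp s))"
  have in_ball: "z * exp s \<in> ball 0 1" if "s \<in> H" for s
  proof -
    have "cmod z * exp (Re s) \<le> cmod z * 1"
      using that by (intro mult_left_mono) (auto simp: H_def)
    then show ?thesis
      using z by (simp add: norm_mult)
  qed
  have FD: "F s \<in> D" if "s \<in> H" for s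
    using fD in_ball[OF that] by (auto simp: F_def)
  have dF: "(F has_field_derivative F1 s) (at s)" if "s \<in> H" for s
    unfolding F_def F1_def
    by (rule DERIV_chain'[where f = "\<lambda>s. z * exp s", OF _ df[OF in_ball[OF that]]]) (auto intro!: derivative_eq_intros)
  have dF1: "(F1 has_field_derivative F2 s) (at s)" if "s \<in> H" for s
    unfolding F1_def F2_def
    by (rule derivative_eq_intros DERIV_chain'[where f = "\<lambda>s. z * exp s", OF _ df1[OF in_ball[OF that]]] refl)+
       (simp add: algebra_simps power2_eq_square)
  have cF: "continuous_on H F" "continuous_on H F1" "continuous_on H F2"
    using in_ball unfolding F_def F1_def F2_def
    by (auto intro!: continuous_intros
          continuous_on_compose2[OF holomorphic_on_imp_continuous_on[OF f]]
          continuous_on_compose2[OF holomorphic_on_imp_continuous_on[OF f1]]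
          continuous_on_compose2[OF holomorphic_on_imp_continuous_on[OF f2]])

  \<comment> \<open>\<open>ut\<close> and \<open>u\<theta>\<close> are the partial derivatives of
    \<open>u (F s)\<close>; the signs in \<open>u\<theta>\<close> come from multiplying
    \<open>F1\<close> by the imaginary unit. \<open>utt\<close> is the second derivative in
    \<open>t\<close>; since \<open>u\<close> is harmonic, the second derivative in \<theta> is
    \<open>- utt\<close>.\<close>
  define ut where "ut = (\<lambda>s. ux (F s) * Re (F1 s) + uy (F s) * Im (F1 s))"
  define u\<theta> where "u\<theta> = (\<lambda>s. uy (F s) * Re (F1 s) - ux (F s) * Im (F1 s))"
  define utt where "utt = (\<lambda>s. (uxx (F s) * Re (F1 s) + uxy (F s) * Im (F1 s)) * Re (F1 s) + ux (F s) * Re (F2 s)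
    + ((uyx (F s) * Re (F1 s) + uyy (F s) * Im (F1 s)) * Im (F1 s) + uy (F s) * Im (F2 s)))"
  have cu: "continuous_on H (\<lambda>s. u (F s))" "continuous_on H ut" "continuous_on H utt"
    using FD unfolding ut_def utt_def
    by (auto intro!: continuous_intros cF c1[THEN continuous_on_compose2] c2[THEN continuous_on_compose2])
  have c_param: "continuous_on ({..0} \<times> {a..b}) (\<lambda>(t, \<theta>). k (Complex t \<theta>))"
    if "continuous_on H k" for k :: "complex \<Rightarrow> real" and a b
    unfolding split_beta
    by (rule continuous_on_compose2[OF that]) (auto intro!: continuous_intros simp: H_def)
  have c_line: "continuous_on {a..b} (\<lambda>\<theta>. k (Complex t \<theta>))"
    if "continuous_on H k" "t \<le> 0" for k :: "complex \<Rightarrow> real" and a b t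
    by (rule continuous_on_compose2[OF that(1)]) (use that(2) in \<open>auto intro!: continuous_intros simp: H_def\<close>)
  have dRe: "((\<lambda>t. Complex t \<theta>) has_vector_derivative 1) (at t within S)" for t \<theta> S
    unfolding Complex_eq by (auto intro!: derivative_eq_intros simp: has_vector_derivative_def scaleR_conv_of_real)
  have dIm: "((\<lambda>\<theta>. Complex t \<theta>) has_vector_derivative \<i>) (at \<theta> within S)" for t \<theta> S
    unfolding Complex_eq by (auto intro!: derivative_eq_intros simp: has_vector_derivative_def scaleR_conv_of_real)
  have H_iff [simp]: "Complex t \<theta> \<in> H \<longleftrightarrow> t \<le> 0" for t \<theta>
    by (simp add: H_def)

  \<comment> \<open>The value wanted is that at \<open>t = 0\<close>, the circle through
    \<open>z\<close> itself, so the half-line is closed and the derivatives there are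
    one-sided.\<close>
  have dt: "((\<lambda>t. u (F (Complex t \<theta>))) has_field_derivative ut (Complex t \<theta>)) (at t within {..0})"
    if "t \<le> 0" for t \<theta>
    using gradient_chain_rule[where \<gamma> = "\<lambda>t. Complex t \<theta>", OF du dF dRe] that FD
    by (simp add: ut_def)
  have dtt: "((\<lambda>t. ut (Complex t \<theta>)) has_field_derivative utt (Complex t \<theta>)) (at t within {..0})"
    if "t \<le> 0" for t \<theta>
  proof -
    have tH: "Complex t \<theta> \<in> H"
      using that by simp
    note ux' = gradient_chain_rule[where \<gamma> = "\<lambda>t. Complex t \<theta>", OF dux dF dRe, OF FD, OF tH tH]
    note uy' = gradient_chain_rule[where \<gamma> = "\<lambda>t. Complex t \<theta>", OF duy dF dRe, OF FD, OF tH tH]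
    note Re' = gradient_chain_rule[where \<gamma> = "\<lambda>t. Complex t \<theta>" and g = Re and gx = 1 and gy = 0, OF _ dF1 dRe, OF _ tH]
    note Im' = gradient_chain_rule[where \<gamma> = "\<lambda>t. Complex t \<theta>" and g = Im and gx = 0 and gy = 1, OF _ dF1 dRe, OF _ tH]
    show ?thesis
      unfolding ut_def
      by (rule DERIV_cong[OF DERIV_add[OF DERIV_mult[OF ux' Re'] DERIV_mult[OF uy' Im']]])
         (auto simp: utt_def algebra_simps intro!: derivative_eq_intros)
  qed
  have d\<theta>\<theta>: "((\<lambda>\<theta>. u\<theta> (Complex t \<theta>)) has_field_derivative - utt (Complex t \<theta>)) (at \<theta> within S)"
    if "t \<le> 0" for t \<theta> S
  proof -
    have lap': "uyy (F (Complex t \<theta>)) = - uxx (F (Complex t \<theta>))"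
      using lap[OF FD[of "Complex t \<theta>"]] that by simp
    have tH: "Complex t \<theta> \<in> H"
      using that by simp
    note ux' = gradient_chain_rule[where \<gamma> = "\<lambda>\<theta>. Complex t \<theta>", OF dux dF dIm, OF FD, OF tH tH]
    note uy' = gradient_chain_rule[where \<gamma> = "\<lambda>\<theta>. Complex t \<theta>", OF duy dF dIm, OF FD, OF tH tH]
    note Re' = gradient_chain_rule[where \<gamma> = "\<lambda>\<theta>. Complex t \<theta>" and g = Re and gx = 1 and gy = 0, OF _ dF1 dIm, OF _ tH]
    note Im' = gradient_chain_rule[where \<gamma> = "\<lambda>\<theta>. Complex t \<theta>" and g = Im and gx = 0 and gy = 1, OF _ dF1 dIm, OF _ tH]
    show ?thesis
      unfolding u\<theta>_def
      by (rule DERIV_cong[OF DERIV_diff[OF DERIV_mult[OF uy' Re'] DERIV_mult[OF ux' Im']]])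
         (auto simp: utt_def lap' algebra_simps intro!: derivative_eq_intros)
  qed

  have leibniz: "((\<lambda>t. integral {0..2 * pi} (\<lambda>\<theta>. k (Complex t \<theta>))) has_field_derivative
      integral {0..2 * pi} (\<lambda>\<theta>. k' (Complex t \<theta>))) (at t within {..0})"
    if "continuous_on H k" "continuous_on H k'" "t \<le> 0"
      and "\<And>t \<theta>. t \<le> 0 \<Longrightarrow> ((\<lambda>t. k (Complex t \<theta>)) has_field_derivative k' (Complex t \<theta>)) (at t within {..0})"
    for k k' :: "complex \<Rightarrow> real" and t
    unfolding cbox_interval[symmetric]
  proof (rule leibniz_rule_field_derivative)
    show "(\<lambda>\<theta>. k (Complex t \<theta>)) integrable_on cbox 0 (2 * pi)" if "t \<in> {..0}" for t
      using that \<open>continuous_on H k\<close> by (simp add: cbox_interval integrable_continuous_real c_line)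
    show "continuous_on ({..0} \<times> cbox 0 (2 * pi)) (\<lambda>(t, \<theta>). k' (Complex t \<theta>))"
      unfolding cbox_interval by (rule c_param) fact
  qed (use that in auto)
  define M where "M = (\<lambda>t. integral {0..2 * pi} (\<lambda>\<theta>. u (F (Complex t \<theta>))))"
  define M1 where "M1 = (\<lambda>t. integral {0..2 * pi} (\<lambda>\<theta>. ut (Complex t \<theta>)))"
  have dM: "(M has_field_derivative M1 t) (at t within {..0})" if "t \<le> 0" for t
    unfolding M_def M1_def by (rule leibniz[OF cu(1,2) that dt])
  \<comment> \<open>The derivative of \<open>M1\<close> is the integral of \<open>utt\<close>, which
    is up to sign the increment of \<open>u\<theta>\<close> over one period; it vanishes because
    \<open>exp\<close> has period \<open>2 pi i\<close>.\<close>
  have dM1: "(M1 has_field_derivative 0) (at t within {..0})" if "t \<le> 0" for t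
  proof -
    have "((\<lambda>\<theta>. - utt (Complex t \<theta>)) has_integral (u\<theta> (Complex t (2 * pi)) - u\<theta> (Complex t 0))) {0..2 * pi}"
      using d\<theta>\<theta>[OF that]
      by (intro fundamental_theorem_of_calculus) (auto simp: has_real_derivative_iff_has_vector_derivative)
    moreover have "Complex t (2 * pi) = Complex t 0 + 2 * of_real pi * \<i>"
      by (simp add: complex_eq_iff)
    then have "u\<theta> (Complex t (2 * pi)) = u\<theta> (Complex t 0)"
      by (simp add: u\<theta>_def F_def F1_def exp_add)
    ultimately have "((\<lambda>\<theta>. - utt (Complex t \<theta>)) has_integral 0) {0..2 * pi}"
      by simp
    then have "integral {0..2 * pi} (\<lambda>\<theta>. utt (Complex t \<theta>)) = 0"
      by (intro integral_unique) (simp add: has_integral_neg_iff)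
    moreover have "(M1 has_field_derivative integral {0..2 * pi} (\<lambda>\<theta>. utt (Complex t \<theta>))) (at t within {..0})"
      unfolding M1_def by (rule leibniz[OF cu(2,3) that dtt])
    ultimately show ?thesis
      by simp
  qed
  obtain c where c: "\<And>t. t \<le> 0 \<Longrightarrow> M1 t = c"
    using has_field_derivative_zero_constant[of "{..0}" M1] dM1 by auto
  have "((\<lambda>t. M t - c * t) has_field_derivative 0) (at t within {..0})" if "t \<le> 0" for t
    using that by (auto intro!: derivative_eq_intros dM simp: c)
  then obtain a where "\<And>t. t \<le> 0 \<Longrightarrow> M t - c * t = a"
    using has_field_derivative_zero_constant[of "{..0}" "\<lambda>t. M t - c * t"] by auto
  then have affine: "M t = a + c * t" if "t \<le> 0" for t
    using that by (metis add.commute diff_add_cancel)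

  \<comment> \<open>In terms of the radius factor \<open>r = exp t\<close>, the limit at minus
    infinity becomes the value at \<open>r = 0\<close>. Admitting negative \<open>r\<close> makes
    \<open>0\<close> an interior point of the interval of continuity.\<close>
  define G where "G = (\<lambda>r. integral {0..2 * pi} (\<lambda>\<theta>. u (f (z * (of_real r * cis \<theta>)))))"
  have "continuous_on {-1..1} G"
    unfolding G_def
  proof (rule integral_continuous_on_param[where a = 0 and b = "2 * pi", unfolded cbox_interval])
    show "continuous_on ({-1..1} \<times> {0..2 * pi}) (\<lambda>(r, \<theta>). u (f (z * (of_real r * cis \<theta>))))"
      unfolding split_beta
    proof (rule continuous_on_compose2[OF c1(1)])
      have "z * (of_real r * cis \<theta>) \<in> ball 0 1" if "\<bar>r\<bar> \<le> 1" for r \<theta>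
        using that z mult_left_mono[of "\<bar>r\<bar>" 1 "cmod z"] by (simp add: norm_mult)
      then show "continuous_on ({-1..1} \<times> {0..2 * pi}) (\<lambda>p. f (z * (of_real (fst p) * cis (snd p))))"
        by (intro continuous_on_compose2[OF holomorphic_on_imp_continuous_on[OF f]])
           (auto intro!: continuous_intros simp: cis_conv_exp abs_le_iff)
      show "(\<lambda>p. f (z * (of_real (fst p) * cis (snd p)))) ` ({-1..1} \<times> {0..2 * pi}) \<subseteq> D"
        using fD \<open>\<And>r \<theta>. \<bar>r\<bar> \<le> 1 \<Longrightarrow> z * (of_real r * cis \<theta>) \<in> ball 0 1\<close> by (force simp: abs_le_iff)
    qed
  qed
  then have "isCont G 0"
    by (rule continuous_on_interior) simp
  then have "((\<lambda>t. G (exp t)) \<longlongrightarrow> G 0) at_bot"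
    by (rule isCont_tendsto_compose[OF _ exp_at_bot])
  moreover have "M = (\<lambda>t. G (exp t))"
    by (simp add: fun_eq_iff M_def G_def F_def exp_eq_polar mult.assoc)
  ultimately have limM: "(M \<longlongrightarrow> G 0) at_bot"
    by simp
  \<comment> \<open>For \<open>t < 0\<close> the quotient equals the slope \<open>c\<close>, so
    convergence of \<open>M\<close> forces \<open>c = 0\<close>.\<close>
  have "((\<lambda>t. (M t - a) * inverse t) \<longlongrightarrow> (G 0 - a) * 0) at_bot"
    by (intro tendsto_intros limM tendsto_mono[OF at_bot_le_at_infinity tendsto_inverse_0])
  moreover have "\<forall>\<^sub>F t in at_bot. (M t - a) * inverse t = c"
    using eventually_gt_at_bot[of 0] by eventually_elim (simp add: affine)
  ultimately have "((\<lambda>t::real. c) \<longlongrightarrow> 0) at_bot"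
    by (simp add: tendsto_cong)
  then have "c = 0"
    by (simp add: tendsto_const_iff)
  have "\<forall>\<^sub>F t in at_bot. M t = a"
    using eventually_gt_at_bot[of 0] by eventually_elim (simp add: affine \<open>c = 0\<close>)
  with limM have "((\<lambda>t::real. a) \<longlongrightarrow> G 0) at_bot"
    by (simp add: tendsto_cong)
  then have "a = G 0"
    by (simp add: tendsto_const_iff)
  then have "M 0 = 2 * pi * u (f 0)"
    by (simp add: affine \<open>c = 0\<close> G_def)
  moreover have "((\<lambda>\<theta>. u (F (Complex 0 \<theta>))) has_integral M 0) {0..2 * pi}"
    unfolding M_def by (intro integrable_integral integrable_continuous_real c_line cu) simp
  ultimately show ?thesis
    by (simp add: F_def exp_eq_polar mult.commute)
qed

section \<open>Membership in weighted Bergman spaces and the general inequality\<close>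

text \<open>
  Each dyadic ring \<open>(1/2)^(n+1) < 1 - |z|\<^sup>2 \<le> (1/2)^n\<close> contributes at most a constant times the
  \<open>n\<close>-th power of \<open>(1/2)\<close> powr \<open>(1 + \<alpha>)\<close>.
\<close>

lemma nn_integral_disc_weight_finite:
  assumes \<alpha>: "- 1 < \<alpha>" "\<alpha> < 0"
  shows "(\<integral>\<^sup>+z\<in>ball (0::complex) 1. ennreal ((1 - (cmod z)\<^sup>2) powr \<alpha>) \<partial>lborel) < \<infinity>"
proof -
  \<comment> \<open>\<open>B n\<close> is the whole collar containing the \<open>n\<close>-th ring;
    overlaps only enlarge the dominating series. \<open>c n\<close> is the weight at the outer edge
    of the ring, which bounds it on the ring since \<alpha> is negative.\<close>
  define B :: "nat \<Rightarrow> complex set" where "B = (\<lambda>n. {z \<in> ball 0 1. 1 - (cmod z)\<^sup>2 \<le> (1/2) ^ n})"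
  define c :: "nat \<Rightarrow> real" where "c = (\<lambda>n. ((1/2) ^ Suc n) powr \<alpha>)"
  have [measurable]: "B n \<in> sets borel" for n
    unfolding B_def by measurable
  have area: "emeasure lborel (B n) \<le> ennreal (pi * (1/2) ^ n)" for n
  proof -
    define r where "r = sqrt (1 - (1/2) ^ n :: real)"
    have pow: "(1/2) ^ n \<le> (1::real)"
      by (simp add: power_le_one)
    then have r: "0 \<le> r" "r\<^sup>2 = 1 - (1/2) ^ n" "r \<le> 1"
      by (simp_all add: r_def)
    have "B n \<subseteq> ball 0 1 - ball 0 r"
    proof
      fix z assume "z \<in> B n"
      then have "r\<^sup>2 \<le> (cmod z)\<^sup>2" "z \<in> ball 0 1"
        by (auto simp: B_def r)
      then show "z \<in> ball 0 1 - ball 0 r"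
        using power2_le_imp_le[of r "cmod z"] by simp
    qed
    then have "emeasure lborel (B n) \<le> emeasure lborel (ball 0 1 - ball (0::complex) r)"
      by (intro emeasure_mono) simp_all
    also have "\<dots> = ennreal pi - ennreal (pi * (1 - (1/2) ^ n))"
      using r subset_ball[of r 1] by (subst emeasure_Diff) (simp_all add: emeasure_ball unit_ball_vol_2)
    also have "\<dots> = ennreal (pi * (1/2) ^ n)"
      using pow by (subst ennreal_minus) (simp_all add: algebra_simps)
    finally show ?thesis .
  qed
  have "ennreal ((1 - (cmod z)\<^sup>2) powr \<alpha>) * indicator (ball 0 1) z \<le> (\<Sum>n. ennreal (c n) * indicator (B n) z)" for z
  proof (cases "z \<in> ball 0 1")
    case True
    define s where "s = 1 - (cmod z)\<^sup>2"
    have s: "0 < s" "s \<le> 1"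
      using True by (simp_all add: s_def power_less_one_iff abs_square_less_1)
    obtain m where "(1/2) ^ m < s"
      using real_arch_pow_inv[OF s(1), of "1/2"] by auto
    \<comment> \<open>\<open>Suc n\<close> is the least exponent with \<open>(1/2) ^ i < s\<close>;
      it is not \<open>0\<close> because \<open>s \<le> 1\<close>. Hence \<open>n\<close> is the
      index of the ring that contains \<open>z\<close>.\<close>
    then obtain n where n: "\<forall>i\<le>n. \<not> (1/2) ^ i < s" "(1/2) ^ Suc n < s"
      using ex_least_nat_less[of "\<lambda>i. (1/2) ^ i < s" m] s by auto
    have "s powr \<alpha> \<le> c n"
      unfolding c_def using n(2) \<alpha> by (intro powr_mono2') auto
    moreover have "z \<in> B n"
      using n(1) True by (auto simp: B_def s_def)
    ultimately have "ennreal (s powr \<alpha>) * indicator (ball 0 1) z \<le> ennreal (c n) * indicator (B n) z"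
      using True by (simp add: ennreal_leI)
    also have "\<dots> \<le> (\<Sum>n. ennreal (c n) * indicator (B n) z)"
      using sum_le_suminf[of "\<lambda>n. ennreal (c n) * indicator (B n) z" "{n}"]
      by (simp only: summableI finite.intros sum.insert sum.empty empty_iff not_False_eq_True add_0_right zero_le simp_thms)
    finally show ?thesis
      by (simp add: s_def)
  qed simp
  then have "(\<integral>\<^sup>+z\<in>ball (0::complex) 1. ennreal ((1 - (cmod z)\<^sup>2) powr \<alpha>) \<partial>lborel)
      \<le> (\<integral>\<^sup>+z. (\<Sum>n. ennreal (c n) * indicator (B n) z) \<partial>lborel)"
    by (rule nn_integral_mono)
  also have "\<dots> = (\<Sum>n. ennreal (c n) * emeasure lborel (B n))"
    by (simp add: nn_integral_suminf nn_integral_cmult)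
  also have "\<dots> \<le> (\<Sum>n. ennreal (c n) * ennreal (pi * (1/2) ^ n))"
    by (intro suminf_le mult_left_mono area summableI) simp_all
  also have "\<dots> = (\<Sum>n. ennreal (((1/2) powr \<alpha> * pi) * ((1/2) powr (1 + \<alpha>)) ^ n))"
  proof -
    have "((1/2) ^ n) powr \<alpha> = ((1/2) powr \<alpha>) ^ n" for n
      using powr_powr_swap[of "1/2" "real n" \<alpha>] by (simp add: powr_realpow)
    then have eq: "c n * (pi * (1/2) ^ n) = ((1/2) powr \<alpha> * pi) * ((1/2) powr (1 + \<alpha>)) ^ n" for n
      unfolding c_def power_Suc powr_mult powr_add by (simp add: power_mult_distrib power_divide)
    have "ennreal (c n) * ennreal (pi * (1/2) ^ n) = ennreal (c n * (pi * (1/2) ^ n))" for n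
      by (rule ennreal_mult[symmetric]) (simp_all add: c_def)
    then show ?thesis
      by (simp only: eq)
  qed
  also have "\<dots> < \<infinity>"
  proof -
    \<comment> \<open>The ratio of the geometric series is below \<open>1\<close> because
      \<open>1 + \<alpha>\<close> is positive.\<close>
    have "(1/2::real) powr (1 + \<alpha>) < 1 powr (1 + \<alpha>)"
      using \<alpha> by (intro powr_less_mono2) auto
    then have "summable (\<lambda>n. ((1/2) powr \<alpha> * pi) * ((1/2) powr (1 + \<alpha>)) ^ n)"
      by (intro summable_mult summable_geometric) simp
    then show ?thesis
      by (simp add: ennreal_suminf_neq_top less_top)
  qed
  finally show ?thesis .
qed

text \<open>Rotation averaging replaces \<open>|f|^p\<close> by its circle means, which the mean
  value property of the majorant bounds by one constant; what remains is the integral of the weight,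
  finite for these \<alpha>.\<close>

lemma harmonic_majorant_imp_in_bergman_space:
  assumes u: "u harmonic_on D" and le_u: "\<And>w. w \<in> D \<Longrightarrow> cmod w powr p \<le> u w"
    and f: "f holomorphic_on ball 0 1" and fD: "f ` ball 0 1 \<subseteq> D"
    and \<alpha>: "- 1 < \<alpha>" "\<alpha> < 0"
  shows "f \<in> bergman_space p \<alpha>"
proof -
  \<comment> \<open>Extension by \<open>0\<close> gives a Borel function on the whole plane, so that
    the integrand can be rotated and the integrals exchanged.\<close>
  define fB where "fB = (\<lambda>z. indicator (ball 0 1) z *\<^sub>R f z)"
  define W where "W = (\<lambda>z. ennreal ((1 - (cmod z)\<^sup>2) powr \<alpha>) * indicator (ball 0 1) z)"
  define g where "g = (\<lambda>z. ennreal (cmod (fB z) powr p) * W z)"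
  define I where "I = (\<integral>\<^sup>+z. g z \<partial>lborel)"
  have [measurable]: "fB \<in> borel_measurable borel"
    unfolding fB_def
    by (intro borel_measurable_continuous_on_indicator holomorphic_on_imp_continuous_on f) simp
  have [measurable]: "ball (0::complex) 1 \<in> sets borel"
    by simp
  have [measurable]: "W \<in> borel_measurable borel"
    unfolding W_def by measurable
  have [measurable]: "g \<in> borel_measurable borel"
    unfolding g_def by measurable
  have [measurable]: "cis \<in> borel_measurable borel"
    by (intro borel_measurable_continuous_onI) (simp add: cis_conv_exp continuous_intros)
  have W_cis: "W (cis \<theta> * z) = W z" for \<theta> z
    by (simp add: W_def norm_mult indicator_def)

  have circle: "(\<integral>\<^sup>+\<theta>\<in>{0..2 * pi}. g (cis \<theta> * z) \<partial>lborel) \<le> ennreal (2 * pi * u (f 0)) * W z" for z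
  proof (cases "z \<in> ball 0 1")
    case True
    then have ball: "cis \<theta> * z \<in> ball 0 1" for \<theta>
      by (simp add: norm_mult)
    have "(\<integral>\<^sup>+\<theta>\<in>{0..2 * pi}. g (cis \<theta> * z) \<partial>lborel)
        \<le> (\<integral>\<^sup>+\<theta>. ennreal (u (f (cis \<theta> * z))) * indicator {0..2 * pi} \<theta> * W z \<partial>lborel)"
      using ball fD
      by (intro nn_integral_mono)
         (auto simp: g_def W_cis fB_def indicator_def intro!: mult_right_mono ennreal_leI le_u)
    also have "\<dots> = (\<integral>\<^sup>+\<theta>. ennreal (u (f (cis \<theta> * z))) * indicator {0..2 * pi} \<theta> \<partial>lborel) * W z"
    proof (rule nn_integral_multc)
      have "continuous_on UNIV (\<lambda>\<theta>. u (f (cis \<theta> * z)))"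
        using ball fD
        by (intro continuous_on_compose2[OF harmonic_on_imp_continuous_on[OF u]]
              continuous_on_compose2[OF holomorphic_on_imp_continuous_on[OF f]])
           (auto intro!: continuous_intros simp: cis_conv_exp)
      then have [measurable]: "(\<lambda>\<theta>. u (f (cis \<theta> * z))) \<in> borel_measurable borel"
        by (rule borel_measurable_continuous_onI)
      show "(\<lambda>\<theta>. ennreal (u (f (cis \<theta> * z))) * indicator {0..2 * pi} \<theta>) \<in> borel_measurable lborel"
        by measurable
    qed
    also have "(\<integral>\<^sup>+\<theta>. ennreal (u (f (cis \<theta> * z))) * indicator {0..2 * pi} \<theta> \<partial>lborel) = ennreal (2 * pi * u (f 0))"
    proof (rule nn_integral_has_integral_lebesgue')
      \<comment> \<open>The majorant inherits nonnegativity from \<open>|w|^p\<close>, so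
        \<open>ennreal\<close> cuts nothing off.\<close>
      show "0 \<le> u (f (cis \<theta> * z))" for \<theta>
        using ball fD by (intro order_trans[OF _ le_u]) auto
    qed (use harmonic_comp_mean_value[OF u f fD] True in auto)
    finally show ?thesis .
  qed (simp add: g_def W_def norm_mult)

  have rotate: "(\<integral>\<^sup>+z. g (cis \<theta> * z) \<partial>lborel) = I" for \<theta>
    by (simp add: nn_integral_lborel_rotate I_def)
  \<comment> \<open>\<open>I\<close> is integrated over a full period of rotations, none of which
    changes it.\<close>
  have "ennreal (2 * pi) * I = (\<integral>\<^sup>+\<theta>. (\<integral>\<^sup>+z. g (cis \<theta> * z) \<partial>lborel) * indicator {0..2 * pi} \<theta> \<partial>lborel)"
    unfolding rotate by (simp add: nn_integral_cmult mult.commute)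
  also have "\<dots> = (\<integral>\<^sup>+\<theta>. \<integral>\<^sup>+z. g (cis \<theta> * z) * indicator {0..2 * pi} \<theta> \<partial>lborel \<partial>lborel)"
    by (subst nn_integral_multc) simp_all
  also have "\<dots> = (\<integral>\<^sup>+z. \<integral>\<^sup>+\<theta>. g (cis \<theta> * z) * indicator {0..2 * pi} \<theta> \<partial>lborel \<partial>lborel)"
    by (rule lborel_pair.Fubini') measurable
  also have "\<dots> \<le> (\<integral>\<^sup>+z. ennreal (2 * pi * u (f 0)) * W z \<partial>lborel)"
    by (intro nn_integral_mono circle)
  also have "\<dots> = ennreal (2 * pi * u (f 0)) * (\<integral>\<^sup>+z. W z \<partial>lborel)"
    by (rule nn_integral_cmult) simp
  also have "\<dots> < \<infinity>"
    using nn_integral_disc_weight_finite[OF \<alpha>] by (simp add: W_def ennreal_mult_less_top)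
  finally have "I < \<infinity>"
    by (auto simp: ennreal_mult_less_top)
  also have "I = (\<integral>\<^sup>+z\<in>ball 0 1. ennreal (cmod (f z) powr p * (1 - (cmod z)\<^sup>2) powr \<alpha>) \<partial>lborel)"
    unfolding I_def by (intro nn_integral_cong) (auto simp: g_def W_def fB_def ennreal_mult indicator_def)
  finally show ?thesis
    by (simp add: bergman_space_def f)
qed

lemma hardy_number_le_bergman_number: "hardy_number D \<le> bergman_number D"
  unfolding hardy_number_def bergman_number_def
proof (intro Sup_least Inf_greatest, clarify)
  fix p :: real and f
  assume p: "0 < p" and "has_harmonic_majorant_on (\<lambda>z. cmod z powr p) D"
    and f: "f holomorphic_on ball 0 1" "f ` ball 0 1 \<subseteq> D"
  then obtain u where u: "u harmonic_on D" "\<And>w. w \<in> D \<Longrightarrow> cmod w powr p \<le> u w"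
    by (auto simp: has_harmonic_majorant_on_def)
  \<comment> \<open>\<open>\<alpha> n\<close> decreases to \<open>-1\<close>, so that
    \<open>p / (\<alpha> n + 2)\<close> tends to \<open>p\<close>; the offset \<open>2\<close> keeps
    \<open>\<alpha> n\<close> negative already at \<open>n = 0\<close>.\<close>
  define \<alpha> :: "nat \<Rightarrow> real" where "\<alpha> = (\<lambda>n. -1 + 1 / (real n + 2))"
  have \<alpha>: "-1 < \<alpha> n" "\<alpha> n < 0" for n
    by (simp_all add: \<alpha>_def field_simps)
  have "ennreal (p / (\<alpha> n + 2)) \<le> bergman_number_fun f" for n
    unfolding bergman_number_fun_def
    using harmonic_majorant_imp_in_bergman_space[OF u f \<alpha>[of n]] p \<alpha>[of n]
    by (intro Sup_upper) blast
  moreover have "(\<lambda>n. p / (\<alpha> n + 2)) \<longlonglongrightarrow> p"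
    unfolding \<alpha>_def by real_asymp
  ultimately show "ennreal p \<le> bergman_number_fun f"
    by (intro LIMSEQ_le_const2[OF tendsto_ennrealI]) auto
qed

section \<open>Domains with bounded complement\<close>

text \<open>The Cayley transform maps the disc onto the right half-plane, so for
  \<open>R > 0\<close> this is a universal covering map of \<open>{w. |w| > R}\<close>.\<close>

definition exp_cayley :: "real \<Rightarrow> complex \<Rightarrow> complex" where
  "exp_cayley R z = of_real R * exp ((1 + z) / (1 - z))"

text \<open>The right-hand side is the Poisson kernel of the disc with pole at \<open>1\<close>. At
  \<open>z = 1\<close> both sides are \<open>0\<close>, by the convention for division by
  zero.\<close>

lemma Re_cayley: "Re ((1 + z) / (1 - z)) = (1 - (cmod z)\<^sup>2) / (cmod (1 - z))\<^sup>2"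
  by (simp add: Re_divide cmod_power2) (simp add: algebra_simps power2_eq_square)

lemma norm_exp_cayley:
  assumes "R > 0"
  shows "cmod (exp_cayley R z) = R * exp ((1 - (cmod z)\<^sup>2) / (cmod (1 - z))\<^sup>2)"
  using assms by (simp add: exp_cayley_def norm_mult Re_cayley)

lemma norm_exp_cayley_gt:
  assumes "R > 0" "z \<in> ball 0 1"
  shows "cmod (exp_cayley R z) > R"
proof -
  have "(cmod z)\<^sup>2 < 1" "z \<noteq> 1"
    using assms(2) by (auto simp: abs_square_less_1)
  then have "(1 - (cmod z)\<^sup>2) / (cmod (1 - z))\<^sup>2 > 0"
    by simp
  then show ?thesis
    using assms(1) by (simp add: norm_exp_cayley)
qed

lemma exp_cayley_holomorphic: "exp_cayley R holomorphic_on ball 0 1"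
  unfolding exp_cayley_def by (auto intro!: holomorphic_intros)

text \<open>
  On the disc of centre \<open>1 - \<delta>\<close> and radius \<open>\<delta> / 2\<close> the real part of \<open>(1 + z) / (1 - z)\<close> is at least
  \<open>2 / (9 \<delta>)\<close>, so that the exponential beats every power of \<open>\<delta>\<close>.
\<close>

lemma exp_cayley_notin_bergman_space:
  assumes R: "R > 0" and p: "p > 0"
  shows "exp_cayley R \<notin> bergman_space p \<alpha>"
proof
  define J where "J = (\<lambda>z. cmod (exp_cayley R z) powr p * (1 - (cmod z)\<^sup>2) powr \<alpha>)"
  \<comment> \<open>With \<open>s = 1 - |z|^2\<close> in \<open>(0, 1]\<close>, the exponent
    \<open>b\<close> gives \<open>s powr b \<le> s powr \<alpha>\<close> for either sign of
    \<alpha>, and \<open>s powr b\<close> is monotone in \<open>s\<close>.\<close>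
  define b where "b = \<bar>\<alpha>\<bar>"
  assume "exp_cayley R \<in> bergman_space p \<alpha>"
  then obtain I where I: "(\<integral>\<^sup>+z\<in>ball 0 1. ennreal (J z) \<partial>lborel) = ennreal I" "I \<ge> 0"
    unfolding bergman_space_def J_def by (auto simp: less_top_ennreal)
  have bound: "(R powr p * exp (2 * p / (9 * \<delta>)) * (\<delta> / 2) powr b) * (pi * (\<delta> / 2)\<^sup>2) \<le> I"
    if \<delta>: "0 < \<delta>" "\<delta> < 1" for \<delta> :: real
  proof -
    define m where "m = R powr p * exp (2 * p / (9 * \<delta>)) * (\<delta> / 2) powr b"
    \<comment> \<open>Points of \<open>S\<close> keep a distance of at least
      \<open>\<delta> / 2\<close> from the unit circle and lie within \<open>3 \<delta> / 2\<close>
      of \<open>1\<close>; these bound numerator and denominator of the Poisson kernel.\<close>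
    define S where "S = ball (of_real (1 - \<delta>) :: complex) (\<delta> / 2)"
    have J: "z \<in> ball 0 1 \<and> m \<le> J z" if "z \<in> S" for z
    proof -
      have d: "cmod (of_real (1 - \<delta>) - z) < \<delta> / 2"
        using that by (simp add: S_def dist_norm)
      have "cmod z \<le> cmod (of_real (1 - \<delta>)) + cmod (of_real (1 - \<delta>) - z)"
        by (metis norm_minus_commute norm_triangle_sub)
      then have z: "cmod z < 1 - \<delta> / 2"
        using d \<delta> by (simp del: of_real_diff)
      have "cmod (1 - z) \<le> cmod (of_real \<delta>) + cmod (of_real (1 - \<delta>) - z)"
        using norm_triangle_ineq[of "of_real \<delta>" "of_real (1 - \<delta>) - z"] by simp
      then have z1: "cmod (1 - z) \<le> 3 / 2 * \<delta>"
        using d \<delta> by simp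
      have "z \<noteq> 1"
        using z \<delta> by auto
      have "(cmod z)\<^sup>2 \<le> cmod z * 1"
        unfolding power2_eq_square using z \<delta> by (intro mult_left_mono) auto
      then have s: "\<delta> / 2 \<le> 1 - (cmod z)\<^sup>2"
        using z by simp
      have "2 / (9 * \<delta>) = (\<delta> / 2) / (3 / 2 * \<delta>)\<^sup>2"
        using \<delta> by (simp add: power2_eq_square field_simps)
      also have "\<dots> \<le> (1 - (cmod z)\<^sup>2) / (cmod (1 - z))\<^sup>2"
        using s z1 \<delta> \<open>z \<noteq> 1\<close> by (intro frac_le power_mono) auto
      finally have "R * exp (2 / (9 * \<delta>)) \<le> cmod (exp_cayley R z)"
        using R by (simp add: norm_exp_cayley)
      then have "(R * exp (2 / (9 * \<delta>))) powr p \<le> cmod (exp_cayley R z) powr p"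
        using R p by (intro powr_mono2) auto
      then have 1: "R powr p * exp (2 * p / (9 * \<delta>)) \<le> cmod (exp_cayley R z) powr p"
        using R by (simp add: powr_mult exp_powr_real)
      have "(\<delta> / 2) powr b \<le> (1 - (cmod z)\<^sup>2) powr b"
        using s \<delta> by (intro powr_mono2) (auto simp: b_def)
      also have "\<dots> \<le> (1 - (cmod z)\<^sup>2) powr \<alpha>"
        using s \<delta> by (intro powr_mono') (auto simp: b_def)
      finally have "m \<le> J z"
        unfolding m_def J_def using 1 by (intro mult_mono) auto
      with z \<delta> show ?thesis
        by simp
    qed
    have "ennreal (m * (pi * (\<delta> / 2)\<^sup>2)) = ennreal m * emeasure lborel S"
      using \<delta> by (simp add: S_def emeasure_ball unit_ball_vol_2 m_def flip: ennreal_mult)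
    also have "\<dots> = (\<integral>\<^sup>+z. ennreal m * indicator S z \<partial>lborel)"
      by (rule nn_integral_cmult_indicator[symmetric]) (simp add: S_def)
    also have "\<dots> \<le> (\<integral>\<^sup>+z\<in>ball 0 1. ennreal (J z) \<partial>lborel)"
      by (intro nn_integral_mono) (use J in \<open>auto simp: indicator_def intro!: ennreal_leI\<close>)
    finally show ?thesis
      using I by (simp add: m_def)
  qed
  have "filterlim (\<lambda>\<delta>. (R powr p * exp (2 * p / (9 * \<delta>)) * (\<delta> / 2) powr b) * (pi * (\<delta> / 2)\<^sup>2)) at_top (at_right 0)"
    using R p by real_asymp
  then have "\<forall>\<^sub>F \<delta> in at_right 0. I + 1 \<le> (R powr p * exp (2 * p / (9 * \<delta>)) * (\<delta> / 2) powr b) * (pi * (\<delta> / 2)\<^sup>2)"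
    by (simp add: filterlim_at_top)
  moreover have "\<forall>\<^sub>F \<delta> in at_right (0::real). \<delta> \<in> {0<..<1}"
    by (rule eventually_at_right_real) simp
  ultimately have "\<forall>\<^sub>F \<delta> in at_right (0::real). False"
    by eventually_elim (use bound in force)
  then show False
    by simp
qed

text \<open>A single map attains the infimum: once \<open>R\<close> bounds the complement,
  \<open>exp_cayley R\<close> sends the disc into \<open>D\<close>, and the supremum defining its
  Bergman number is over the empty set.\<close>

lemma bergman_number_eq_0:
  assumes "bounded (UNIV - D)"
  shows "bergman_number D = 0"
proof -
  obtain R where R: "R > 0" "\<And>w. w \<notin> D \<Longrightarrow> cmod w \<le> R"
    using assms by (auto simp: bounded_pos)
  then have "exp_cayley R ` ball 0 1 \<subseteq> D"
    using norm_exp_cayley_gt by force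
  then have "bergman_number D \<le> bergman_number_fun (exp_cayley R)"
    unfolding bergman_number_def using exp_cayley_holomorphic by (intro Inf_lower) auto
  also have "{ennreal (p / (\<alpha> + 2)) | p \<alpha>. p > 0 \<and> \<alpha> > -1 \<and> exp_cayley R \<in> bergman_space p \<alpha>} = {}"
    using exp_cayley_notin_bergman_space[OF R(1)] by auto
  then have "bergman_number_fun (exp_cayley R) = 0"
    unfolding bergman_number_fun_def by (simp only: Sup_empty bot_ennreal)
  finally show ?thesis
    by simp
qed

section \<open>Bounded domains and the conclusion\<close>

lemma const_harmonic_on: "(\<lambda>_. c) harmonic_on D"
  unfolding harmonic_on_def
  by (intro exI[of _ "\<lambda>_. 0"]) simp

text \<open>Constants are harmonic majorants of every positive power, so the supremum exceeds every
  natural number.\<close>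

lemma hardy_number_eq_top:
  assumes "bounded D"
  shows "hardy_number D = \<infinity>"
proof -
  obtain B where B: "\<And>w. w \<in> D \<Longrightarrow> cmod w \<le> B"
    using assms by (auto simp: bounded_iff)
  have "ennreal (real n) \<le> hardy_number D" if "n > 0" for n
    unfolding hardy_number_def has_harmonic_majorant_on_def
  proof (intro Sup_upper CollectI exI conjI)
    show "(\<lambda>_. B powr real n) harmonic_on D"
      by (rule const_harmonic_on)
    show "\<forall>w\<in>D. cmod w powr real n \<le> B powr real n"
      using B by (intro ballI powr_mono2) auto
  qed (use that in auto)
  then show ?thesis
    by (metis ennreal_Ex_less_of_nat ennreal_of_nat_eq_real_of_nat gr_zeroI infinity_ennreal_def
        less_top linorder_not_less not_less_zero of_nat_0)
qed

theorem lemma2p2: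
  fixes D :: "complex set"
  assumes "open D" and "connected D" and "D \<noteq> {}"
  shows "hardy_number D \<le> bergman_number D \<and>
    (bounded D \<longrightarrow> hardy_number D = \<infinity> \<and> bergman_number D = \<infinity>) \<and>
    (bounded (UNIV - D) \<longrightarrow> hardy_number D = 0 \<and> bergman_number D = 0)"
  \<comment> \<open>In each special case one number is computed and the inequality yields the other:
    an infinite Hardy number pushes the Bergman number up, a zero Bergman number pushes the Hardy
    number down.\<close>
  using hardy_number_le_bergman_number[of D] hardy_number_eq_top[of D] bergman_number_eq_0[of D]
  by (auto simp: top_unique)

end
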